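(* Let $p_n$ be the probability that a uniformly chosen admissible sign pattern on a ground set of size $n$ is representable. Then $\lim_{n\to\infty} p_n = 0$, and in fact $-\log_2(p_n) \ge \Omega(2^n)$, i.e. there is a constant $c>0$ such that $-\log_2(p_n) \ge c\, 2^n$ for all sufficiently large $n$.
   Context: Let $N$ be a finite set of size $n$. A sign pattern on $N$ is a function $s: 2^N \to \{+,-\}$. It is admissible if $s(\emptyset) = +$ and, for all $i \neq j$ in $N$ and all $K \subseteq N \setminus \{i,j\}$, the implication $[s(K\cup\{i\}) \neq s(K \cup\{j\})] \implies [s(K) \neq s(K\cup\{i,j\})]$ holds. It is representable if there is a real symmetric matrix $\Sigma$ with rows and columns indexed by $N$, all of whose principal minors are non-zero, such that $s(K)$ is the sign of the principal minor $\det \Sigma_{K,K}$ for every $K \subseteq N$ (with the minor for $K=\emptyset$ equal to $1$). Every representable sign pattern is admissible. *)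

theory Defs
  imports
    "HOL-Probability.Probability_Mass_Function"
    "Jordan_Normal_Form.Determinant"
    "Jordan_Normal_Form.DL_Submatrix"
begin

text \<open>
  The ground set of size \<open>n\<close> is \<open>{..<n}\<close>; this matches the index set of an \<open>n\<close> by \<open>n\<close> matrix.
  The signs \<open>+\<close> and \<open>-\<close> are the reals \<open>1\<close> and \<open>-1\<close>, so that \<open>sgn\<close> gives the sign of a
  non-zero minor. A sign pattern is a function on nat sets; requiring it to be \<open>undefined\<close>
  off the subsets of the ground set makes the sign patterns a finite set which can be counted.
\<close>

definition sign_patterns :: "nat \<Rightarrow> (nat set \<Rightarrow> real) set" where
  "sign_patterns n = Pow {..<n} \<rightarrow>\<^sub>E {1, -1}"

definition admissible :: "nat \<Rightarrow> (nat set \<Rightarrow> real) \<Rightarrow> bool" where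
  "admissible n s \<longleftrightarrow> s \<in> sign_patterns n \<and> s {} = 1 \<and>
     (\<forall>i\<in>{..<n}. \<forall>j\<in>{..<n}. \<forall>K. i \<noteq> j \<longrightarrow> K \<subseteq> {..<n} - {i, j} \<longrightarrow>
        s (K \<union> {i}) \<noteq> s (K \<union> {j}) \<longrightarrow> s K \<noteq> s (K \<union> {i, j}))"

text \<open>The determinant of the empty matrix is \<open>1\<close>, which is the convention for \<open>K = {}\<close>.\<close>

definition principal_minor :: "real mat \<Rightarrow> nat set \<Rightarrow> real" where
  "principal_minor A K = det (submatrix A K K)"

definition representable :: "nat \<Rightarrow> (nat set \<Rightarrow> real) \<Rightarrow> bool" where
  "representable n s \<longleftrightarrow> s \<in> sign_patterns n \<and>
     (\<exists>A \<in> carrier_mat n n. transpose_mat A = A \<and>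
        (\<forall>K \<subseteq> {..<n}. principal_minor A K \<noteq> 0 \<and> s K = sgn (principal_minor A K)))"

definition representable_prob :: "nat \<Rightarrow> real" where
  "representable_prob n =
     measure_pmf.prob (pmf_of_set {s. admissible n s}) {s. representable n s}"

text \<open>
  The set of admissible patterns is finite and non-empty, so the uniform distribution on it is
  the intended one; moreover the probability is positive, so its logarithm is a genuine one.
\<close>

lemma finite_admissible: "finite {s. admissible n s}"
proof (rule finite_subset)
  show "{s. admissible n s} \<subseteq> sign_patterns n"
    by (auto simp: admissible_def)
  show "finite (sign_patterns n)"
    unfolding sign_patterns_def by (intro finite_PiE) auto
qed

lemma admissible_const: "admissible n (\<lambda>K\<in>Pow {..<n}. 1)"
proof -
  have "K \<subseteq> {..<n}" if "K \<subseteq> {..<n} - {i, j}" for K i j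
    using that by auto
  then show ?thesis
    by (auto simp: admissible_def sign_patterns_def)
qed

lemma admissible_nonempty: "{s. admissible n s} \<noteq> {}"
  using admissible_const by blast

lemma principal_minor_one: "principal_minor (1\<^sub>m n) K = 1"
proof -
  let ?m = "card {i. i < n \<and> i \<in> K}"
  have "submatrix (1\<^sub>m n) K K = (1\<^sub>m ?m :: real mat)"
  proof (rule eq_matI)
    fix i j assume "i < dim_row (1\<^sub>m ?m :: real mat)" "j < dim_col (1\<^sub>m ?m :: real mat)"
    then have i: "i < ?m" and j: "j < ?m" by simp_all
    have "pick K i < n" "pick K j < n"
      using i j pick_le by auto
    moreover have "pick K i = pick K j \<longleftrightarrow> i = j"
    proof -
      have "card {i. i < n \<and> i \<in> K} \<le> card K" if "finite K"
        using that by (intro card_mono) auto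
      then have "finite K \<Longrightarrow> i < card K" "finite K \<Longrightarrow> j < card K"
        using i j by auto
      then show ?thesis
        by (metis less_irrefl linorder_neq_iff pick_mono_inf pick_mono_le)
    qed
    ultimately show "submatrix (1\<^sub>m n) K K $$ (i, j) = (1\<^sub>m ?m :: real mat) $$ (i, j)"
      using i j by (simp add: submatrix_index)
  qed (simp_all add: dim_submatrix)
  then show ?thesis
    by (simp add: principal_minor_def)
qed

lemma representable_const: "representable n (\<lambda>K\<in>Pow {..<n}. 1)"
  unfolding representable_def
proof (intro conjI bexI[of _ "1\<^sub>m n"])
  show "(\<lambda>K\<in>Pow {..<n}. 1) \<in> sign_patterns n"
    by (simp add: sign_patterns_def)
qed (auto simp: principal_minor_one)

lemma representable_prob_pos: "representable_prob n > 0"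
proof -
  have "(\<lambda>K\<in>Pow {..<n}. 1) \<in> {s. admissible n s} \<inter> {s. representable n s}"
    using admissible_const representable_const by blast
  then have "card ({s. admissible n s} \<inter> {s. representable n s}) > 0"
    using finite_admissible by (metis card_gt_0_iff empty_iff finite_Int)
  then show ?thesis
    unfolding representable_prob_def
    using measure_pmf_of_set[OF admissible_nonempty finite_admissible]
      finite_admissible admissible_nonempty by (simp add: card_gt_0_iff)
qed

end

theory Submission
  imports Defs
begin

text \<open>
  Let \<open>R n\<close> be the number of representable patterns. If \<open>s\<close> is represented by \<open>A\<close>, then its restriction
  to the sets without the last index and (up to a global sign) its restriction to the sets containing it
  are represented by a submatrix and by a Schur complement of \<open>A\<close>. Hence
  \<open>2 R (n + 1) \<le> (2 R n)\<^sup>2\<close> and \<open>2 R (m + l) \<le> (2 R m) ^ 2 ^ l\<close>. On the other hand there are at least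
  \<open>2 ^ 2 ^ (n - 1)\<close> admissible patterns, so it suffices to know \<open>log\<^sub>2 (2 R m)\<close> to be smaller than
  \<open>2 ^ (m - 1)\<close> by a constant factor for a single \<open>m\<close>.

  For \<open>m = 16\<close> this follows from a weak form of Warren's bound on the number of sign vectors of
  polynomials: every sign cell contains a nondegenerate solution of one polynomial system with as many
  equations as unknowns, and the number of such solutions is bounded by counting dimensions.
\<close>

section \<open>Linear relations and vanishing polynomials\<close>

text \<open>Gaussian elimination, one unknown per equation. It will supply a linear relation among
  functions that outnumber the monomials in which they are expanded.\<close>

lemma underdetermined_system:
  fixes c :: "'i \<Rightarrow> 'a \<Rightarrow> real"
  assumes "finite A" "finite I" "card A < card I"
  shows "\<exists>v. (\<exists>i\<in>I. v i \<noteq> 0) \<and> (\<forall>a\<in>A. (\<Sum>i\<in>I. v i * c i a) = 0)"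
  using assms
proof (induction A arbitrary: I c rule: finite_induct)
  case empty
  then have "I \<noteq> {}" by auto
  then show ?case by (intro exI[of _ "\<lambda>_. 1"]) auto
next
  case (insert a A)
  show ?case
  proof (cases "\<forall>i\<in>I. c i a = 0")
    case True
    have "card A < card I" using insert by simp
    from insert.IH[OF insert.prems(1) this, of c] show ?thesis
      using True by auto
  next
    case False
    then obtain j where j: "j \<in> I" "c j a \<noteq> 0" by auto
    let ?J = "I - {j}"
    have "card A < card ?J" using insert j by auto
    from insert.IH[OF _ this, of "\<lambda>i b. c i b - c i a / c j a * c j b"] insert.prems
    obtain v i0 where i0: "i0 \<in> ?J" "v i0 \<noteq> 0"
      and v: "\<And>b. b \<in> A \<Longrightarrow> (\<Sum>i\<in>?J. v i * (c i b - c i a / c j a * c j b)) = 0"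
      by auto
    define w where "w = v(j := - (\<Sum>i\<in>?J. v i * c i a) / c j a)"
    have w: "(\<Sum>i\<in>I. w i * c i b) = w j * c j b + (\<Sum>i\<in>?J. v i * c i b)" for b
      using insert.prems j
      by (subst sum.remove[of _ j]) (auto simp: w_def intro!: sum.cong)
    have "(\<Sum>i\<in>I. w i * c i b) = 0" if "b \<in> A" for b
    proof -
      have "(\<Sum>i\<in>?J. v i * c i b) = (\<Sum>i\<in>?J. v i * c i a) / c j a * c j b"
        using v[OF that]
        by (simp add: algebra_simps sum_subtractf sum_distrib_left sum_distrib_right sum_divide_distrib)
      then show ?thesis unfolding w by (simp add: w_def)
    qed
    moreover have "(\<Sum>i\<in>I. w i * c i a) = 0"
      unfolding w using j by (simp add: w_def)
    moreover have "w i0 \<noteq> 0" using i0 by (auto simp: w_def)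
    ultimately show ?thesis using i0 by (intro exI[of _ w]) auto
  qed
qed

text \<open>Collecting powers of one variable and freezing the others leaves a one-variable
  polynomial that vanishes everywhere; its coefficients are vanishing polynomials in fewer
  variables.\<close>

lemma multivariate_coeffs_eq_0:
  fixes c :: "('i \<Rightarrow> nat) \<Rightarrow> real"
  assumes "finite I" "a \<in> I \<rightarrow>\<^sub>E {..S}"
    and "\<And>z :: 'i \<Rightarrow> real. (\<Sum>a\<in>I \<rightarrow>\<^sub>E {..S}. c a * (\<Prod>i\<in>I. z i ^ a i)) = 0"
  shows "c a = 0"
  using assms
proof (induction I arbitrary: c a rule: finite_induct)
  case empty
  then show ?case by simp
next
  case (insert i I)
  let ?P = "I \<rightarrow>\<^sub>E {..S}"
  have eq: "(\<Sum>a\<in>insert i I \<rightarrow>\<^sub>E {..S}. c a * (\<Prod>j\<in>insert i I. z j ^ a j)) =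
      (\<Sum>y\<le>S. (\<Sum>b\<in>?P. c (b(i := y)) * (\<Prod>j\<in>I. z j ^ b j)) * z i ^ y)" for z :: "'i \<Rightarrow> real"
  proof -
    have *: "(\<Prod>j\<in>I. z j ^ (if j = i then y else b j)) = (\<Prod>j\<in>I. z j ^ b j)" for b y
      using insert by (intro prod.cong) auto
    have "(\<Sum>a\<in>insert i I \<rightarrow>\<^sub>E {..S}. c a * (\<Prod>j\<in>insert i I. z j ^ a j)) =
        (\<Sum>(y, b)\<in>{..S} \<times> ?P. c (b(i := y)) * (\<Prod>j\<in>insert i I. z j ^ (b(i := y)) j))"
      unfolding PiE_insert_eq using insert.hyps
      by (subst sum.reindex) (use inj_combinator[of i I "\<lambda>_. {..S}"] in \<open>auto simp: case_prod_unfold\<close>)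
    also have "\<dots> = (\<Sum>y\<le>S. \<Sum>b\<in>?P. c (b(i := y)) * (\<Prod>j\<in>insert i I. z j ^ (b(i := y)) j))"
      by (simp add: sum.cartesian_product)
    also have "\<dots> = (\<Sum>y\<le>S. (\<Sum>b\<in>?P. c (b(i := y)) * (\<Prod>j\<in>I. z j ^ b j)) * z i ^ y)"
      using insert.hyps by (simp add: * sum_distrib_left mult_ac)
    finally show ?thesis .
  qed
  have zero: "(\<Sum>b\<in>?P. c (b(i := y)) * (\<Prod>j\<in>I. z j ^ b j)) = 0" if "y \<le> S" for y and z :: "'i \<Rightarrow> real"
  proof -
    have *: "(\<Prod>j\<in>I. (z(i := t)) j ^ b j) = (\<Prod>j\<in>I. z j ^ b j)" for t b
      using insert by (intro prod.cong) auto
    have "\<forall>t. (\<Sum>y\<le>S. (\<Sum>b\<in>?P. c (b(i := y)) * (\<Prod>j\<in>I. z j ^ b j)) * t ^ y) = 0"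
      using insert.prems(2)[unfolded eq, of "z(i := _)"] by (simp only: * fun_upd_same simp_thms)
    then show ?thesis using that by (simp add: polyfun_eq_0)
  qed
  obtain y b where a: "y \<le> S" "b \<in> ?P" "a = b(i := y)"
    using insert.prems(1) unfolding PiE_insert_eq by auto
  show ?case
    using insert.IH[OF a(2) zero[OF a(1)]] unfolding a(3) .
qed

subsection \<open>Polynomial functions of bounded degree in each variable\<close>

text \<open>\<open>polyf T f\<close> bounds the degree in each variable separately, so that the monomials
  needed to write \<open>f\<close> are indexed by a box and easily counted.\<close>

inductive polyf :: "nat \<Rightarrow> (real ^ 'k \<Rightarrow> real) \<Rightarrow> bool" where
  const: "polyf T (\<lambda>x. c)"
| coord: "polyf 1 (\<lambda>x. vec_nth x i)"
| add: "polyf T f \<Longrightarrow> polyf T g \<Longrightarrow> polyf T (\<lambda>x. f x + g x)"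
| mult: "polyf S f \<Longrightarrow> polyf T g \<Longrightarrow> polyf (S + T) (\<lambda>x. f x * g x)"
| mono: "polyf S f \<Longrightarrow> S \<le> T \<Longrightarrow> polyf T f"

lemma polyf_sum: "finite I \<Longrightarrow> (\<And>i. i \<in> I \<Longrightarrow> polyf T (f i)) \<Longrightarrow> polyf T (\<lambda>x. \<Sum>i\<in>I. f i x)"
  by (induction I rule: finite_induct) (auto intro: polyf.const polyf.add)

lemma polyf_prod:
  "finite I \<Longrightarrow> (\<And>i. i \<in> I \<Longrightarrow> polyf (T i) (f i)) \<Longrightarrow> polyf (\<Sum>i\<in>I. T i) (\<lambda>x. \<Prod>i\<in>I. f i x)"
  by (induction I rule: finite_induct) (auto intro: polyf.const polyf.mult)

lemma polyf_power: "polyf T f \<Longrightarrow> polyf (n * T) (\<lambda>x. f x ^ n)"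
  by (induction n) (auto intro: polyf.const polyf.mult)

lemma polyf_cmult: "polyf T f \<Longrightarrow> polyf T (\<lambda>x. c * f x)"
  using polyf.mult[OF polyf.const[of 0 c]] by simp

lemma polyf_diff: "polyf T f \<Longrightarrow> polyf T g \<Longrightarrow> polyf T (\<lambda>x. f x - g x)"
  using polyf.add[OF _ polyf_cmult[of T g "-1"]] by simp

text \<open>The sum and product rules respect the degree bound. It is not lowered, so that one bound
  serves a function and all its partial derivatives.\<close>

lemma polyf_has_derivative:
  fixes f :: "real ^ 'k \<Rightarrow> real"
  assumes "polyf T f"
  shows "\<exists>d. (\<forall>i. polyf T (d i)) \<and> (\<forall>x. (f has_derivative (\<lambda>h. \<Sum>i\<in>UNIV. d i x * vec_nth h i)) (at x))"
  using assms
proof induction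
  case (const T c)
  show ?case
    by (intro exI[of _ "\<lambda>i x. 0"]) (auto intro: polyf.const)
next
  case (coord i)
  have "((\<lambda>x. vec_nth x i) has_derivative (\<lambda>h. \<Sum>j\<in>UNIV. (if j = i then 1 else 0) * vec_nth h j)) (at x)"
    for x :: "real ^ 'k"
    by (auto simp: if_distrib[of "\<lambda>y. y * _"] cong: if_cong
      intro!: bounded_linear.has_derivative[OF bounded_linear_vec_nth] derivative_eq_intros)
  then show ?case
    by (intro exI[of _ "\<lambda>j x. if j = i then 1 else 0"]) (auto intro: polyf.const)
next
  case (add T f g)
  then obtain d e where *: "\<And>i. polyf T (d i)" "\<And>i. polyf T (e i)"
    "\<And>x. (f has_derivative (\<lambda>h. \<Sum>i\<in>UNIV. d i x * vec_nth h i)) (at x)"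
    "\<And>x. (g has_derivative (\<lambda>h. \<Sum>i\<in>UNIV. e i x * vec_nth h i)) (at x)"
    by blast
  show ?case
    by (rule exI[of _ "\<lambda>i x. d i x + e i x"])
      (auto intro!: polyf.add derivative_eq_intros * simp: sum.distrib algebra_simps)
next
  case (mult S f T g)
  then obtain d e where *: "\<And>i. polyf S (d i)" "\<And>i. polyf T (e i)"
    "\<And>x. (f has_derivative (\<lambda>h. \<Sum>i\<in>UNIV. d i x * vec_nth h i)) (at x)"
    "\<And>x. (g has_derivative (\<lambda>h. \<Sum>i\<in>UNIV. e i x * vec_nth h i)) (at x)"
    by blast
  have "((\<lambda>x. f x * g x) has_derivative
      (\<lambda>h. \<Sum>i\<in>UNIV. (d i x * g x + f x * e i x) * vec_nth h i)) (at x)" for x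
    by (auto intro!: derivative_eq_intros *
        simp: sum.distrib algebra_simps sum_distrib_left sum_distrib_right)
  moreover have "polyf (S + T) (\<lambda>x. d i x * g x + f x * e i x)" for i
    by (intro polyf.add polyf.mult * mult.hyps)
  ultimately show ?case
    by (intro exI[of _ "\<lambda>i x. d i x * g x + f x * e i x"]) blast
next
  case (mono S f T)
  then show ?case by (meson polyf.mono)
qed

abbreviation exponents :: "nat \<Rightarrow> ('k \<Rightarrow> nat) set" where
  "exponents T \<equiv> UNIV \<rightarrow>\<^sub>E {..T}"

lemma finite_exponents: "finite (exponents T :: ('k::finite \<Rightarrow> nat) set)"
  by (intro finite_PiE) auto

lemma card_exponents: "card (exponents T :: ('k::finite \<Rightarrow> nat) set) = (T + 1) ^ CARD('k)"
  by (simp add: card_PiE)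

text \<open>Expansions over a box of exponents survive every formation rule of \<open>polyf\<close>:
  products add exponents coordinatewise, and a smaller box embeds in a larger one.\<close>

lemma polyf_coeffs:
  fixes f :: "real ^ 'k \<Rightarrow> real"
  assumes "polyf T f"
  shows "\<exists>c. \<forall>x. f x = (\<Sum>a\<in>exponents T. c a * (\<Prod>i\<in>UNIV. vec_nth x i ^ a i))"
proof -
  define R where "R T f \<longleftrightarrow> (\<exists>c. \<forall>x. f x = (\<Sum>a\<in>exponents T. c a * (\<Prod>i\<in>UNIV. vec_nth x i ^ a i)))"
    for T and f :: "real ^ 'k \<Rightarrow> real"
  note fin = finite_exponents[where 'k = 'k]
  have monomial: "R T (\<lambda>x. y * (\<Prod>i\<in>UNIV. vec_nth x i ^ a i))" if "a \<in> exponents T" for a T y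
    unfolding R_def using that fin
    by (intro exI[of _ "\<lambda>b. if b = a then y else 0"]) (auto simp: if_distrib[of "\<lambda>y. y * _"] cong: if_cong)
  have radd: "R T (\<lambda>x. f x + g x)" if "R T f" "R T g" for T f g
  proof -
    from that obtain c d where "\<forall>x. f x = (\<Sum>a\<in>exponents T. c a * (\<Prod>i\<in>UNIV. vec_nth x i ^ a i))"
      "\<forall>x. g x = (\<Sum>a\<in>exponents T. d a * (\<Prod>i\<in>UNIV. vec_nth x i ^ a i))"
      unfolding R_def by blast
    then show ?thesis unfolding R_def
      by (intro exI[of _ "\<lambda>a. c a + d a"]) (simp add: algebra_simps sum.distrib)
  qed
  have rsum: "R T (\<lambda>x. \<Sum>j\<in>J. f j x)" if "finite J" "\<And>j. j \<in> J \<Longrightarrow> R T (f j)" for T f and J :: "'j set"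
    using that
  proof (induction J rule: finite_induct)
    case empty
    show ?case unfolding R_def by (intro exI[of _ "\<lambda>_. 0"]) auto
  next
    case (insert j J)
    then show ?case by (auto intro: radd)
  qed
  from assms have "R T f"
  proof induction
    case (const T c)
    have "(\<lambda>_. 0) \<in> exponents T" by auto
    from monomial[OF this, of c] show ?case by simp
  next
    case (coord i)
    have "(\<Prod>j\<in>UNIV. vec_nth x j ^ (if j = i then 1 else 0)) = vec_nth x i" for x :: "real ^ 'k"
      by (simp add: if_distrib[of "\<lambda>n. _ ^ n"] cong: if_cong)
    moreover have "(\<lambda>j. if j = i then 1 else 0) \<in> exponents 1" by auto
    from monomial[OF this, of 1] show ?case by (simp add: calculation)
  next
    case (add T f g)
    then show ?case by (rule_tac radd)
  next
    case (mult S f T g)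
    from mult.IH obtain c d where *: "\<And>x. f x = (\<Sum>a\<in>exponents S. c a * (\<Prod>i\<in>UNIV. vec_nth x i ^ a i))"
      "\<And>x. g x = (\<Sum>a\<in>exponents T. d a * (\<Prod>i\<in>UNIV. vec_nth x i ^ a i))"
      unfolding R_def by blast
    have "R (S + T) (\<lambda>x. \<Sum>a\<in>exponents S. \<Sum>b\<in>exponents T. (c a * d b) * (\<Prod>i\<in>UNIV. vec_nth x i ^ (a i + b i)))"
      by (intro rsum monomial fin) (auto simp: PiE_iff intro: add_mono)
    moreover have "(\<lambda>x. f x * g x) =
        (\<lambda>x. \<Sum>a\<in>exponents S. \<Sum>b\<in>exponents T. (c a * d b) * (\<Prod>i\<in>UNIV. vec_nth x i ^ (a i + b i)))"
      by (simp add: * sum_product power_add prod.distrib mult_ac)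
    ultimately show ?case by simp
  next
    case (mono S f T)
    from mono.IH obtain c where *: "\<And>x. f x = (\<Sum>a\<in>exponents S. c a * (\<Prod>i\<in>UNIV. vec_nth x i ^ a i))"
      unfolding R_def by blast
    have "R T (\<lambda>x. \<Sum>a\<in>exponents S. c a * (\<Prod>i\<in>UNIV. vec_nth x i ^ a i))"
      using mono.hyps by (intro rsum monomial fin) (auto simp: PiE_iff intro: order_trans)
    then show ?case using * by presburger
  qed
  then show ?thesis unfolding R_def .
qed

text \<open>Chain rule along a line through \<open>p\<close>; as \<open>f p = 0\<close>, the
  difference quotient is \<open>f\<close> divided by \<open>t\<close>.\<close>

lemma directional_limit:
  fixes f :: "real ^ 'k \<Rightarrow> real"
  assumes "(f has_derivative f') (at p)" "f p = 0"
  shows "((\<lambda>t. f (p + t *\<^sub>R y) / t) \<longlongrightarrow> f' y) (at 0)"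
proof -
  have "((\<lambda>t. f (p + t *\<^sub>R y)) has_derivative (\<lambda>t. f' (t *\<^sub>R y))) (at 0)"
    by (rule has_derivative_compose[where g = f and f = "\<lambda>t. p + t *\<^sub>R y"])
      (auto intro!: derivative_eq_intros assms)
  moreover have "f' (t *\<^sub>R y) = f' y * t" for t
    using linear_scale[OF has_derivative_linear[OF assms(1)], of t y] by simp
  ultimately have "((\<lambda>t. f (p + t *\<^sub>R y)) has_field_derivative f' y) (at 0)"
    by (simp add: has_field_derivative_def)
  then show ?thesis
    using assms(2) by (simp add: has_field_derivative_iff)
qed

subsection \<open>Counting nondegenerate zeros\<close>

text \<open>Lagrange interpolation by a product of affine factors, one for each \<open>q\<close>
  other than \<open>p\<close>. It separates the local analyses at different zeros.\<close>

lemma lagrange_polyf: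
  fixes P :: "(real ^ 'k) set"
  assumes "finite P" "p \<in> P"
  shows "\<exists>e. polyf (card P) e \<and> e p = 1 \<and> (\<forall>q\<in>P - {p}. e q = 0)"
proof -
  \<comment> \<open>\<open>l q\<close> measures the position along \<open>p - q\<close>, normalised
    to be 0 at \<open>q\<close> and 1 at \<open>p\<close>.\<close>
  define l where "l q x = (\<Sum>i\<in>UNIV. (vec_nth p i - vec_nth q i) / inner (p - q) (p - q) * vec_nth x i)
      - inner (p - q) q / inner (p - q) (p - q)" for q x
  have l: "l q x = inner (p - q) (x - q) / inner (p - q) (p - q)" for q x
  proof -
    have "(\<Sum>i\<in>UNIV. (vec_nth p i - vec_nth q i) / c * vec_nth x i) = inner (p - q) x / c" for c
      by (simp add: inner_vec_def sum_divide_distrib)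
    then show ?thesis
      by (simp only: l_def inner_diff_right[of _ x q] diff_divide_distrib)
  qed
  define e where "e x = (\<Prod>q\<in>P - {p}. l q x)" for x
  have "polyf (\<Sum>q\<in>P - {p}. 1) e" unfolding e_def l_def using assms
    by (intro polyf_prod polyf_diff polyf.const polyf_sum polyf_cmult polyf.coord) auto
  then have "polyf (card P) e" using assms by (auto elim: polyf.mono simp: card_Diff_singleton)
  moreover have "e p = 1" unfolding e_def by (intro prod.neutral) (auto simp: l)
  moreover have "e q = 0" if "q \<in> P - {p}" for q
    unfolding e_def using assms that by (intro prod_zero bexI[of _ q]) (auto simp: l)
  ultimately show ?thesis by blast
qed

text \<open>Near a nondegenerate zero the \<open>g i\<close> are local coordinates, so the lowest-order part
  of a linear relation among these functions is a homogeneous polynomial that vanishes.\<close>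

lemma independent_at_nondegenerate_zeros:
  fixes g :: "'k::finite \<Rightarrow> real ^ 'k \<Rightarrow> real" and P :: "(real ^ 'k) set"
  assumes "finite P"
    and zero: "\<And>p i. p \<in> P \<Longrightarrow> g i p = 0"
    and deriv: "\<And>p. p \<in> P \<Longrightarrow> \<exists>g'. ((\<lambda>x. \<chi> i. g i x) has_derivative g') (at p) \<and> surj g'"
    and cont: "\<And>p. isCont (e p) p0" and e: "\<And>p. p \<in> P \<Longrightarrow> e p p0 = (if p = p0 then 1 else 0)"
    and p0: "p0 \<in> P" "a0 \<in> exponents N" "v (p0, a0) \<noteq> 0"
    and minimal: "\<And>p a. p \<in> P \<Longrightarrow> a \<in> exponents N \<Longrightarrow> v (p, a) \<noteq> 0 \<Longrightarrow> sum a0 UNIV \<le> sum a UNIV"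
    and rel: "\<And>x. (\<Sum>(p, a)\<in>P \<times> exponents N. v (p, a) * (e p x * (\<Prod>i\<in>UNIV. g i x ^ a i))) = 0"
  shows False
proof -
  define r where "r = sum a0 UNIV"
  obtain g' where g': "((\<lambda>x. \<chi> i. g i x) has_derivative g') (at p0)" "surj g'"
    using deriv p0 by blast
  have gi: "(g i has_derivative (\<lambda>h. vec_nth (g' h) i)) (at p0)" for i
    using bounded_linear.has_derivative[OF bounded_linear_vec_nth g'(1), of i] by simp
  have lim_zero: "(\<Sum>(p, a)\<in>P \<times> exponents N. v (p, a) * (e p p0 * (\<Prod>i\<in>UNIV. vec_nth (g' y) i ^ a i))
      * 0 ^ (sum a UNIV - r)) = 0" for y
  proof -
    \<comment> \<open>The relation at \<open>p0 + t *\<^sub>R y\<close> divided by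
      \<open>t ^ r\<close>, with a factor \<open>1 / t\<close> moved to each \<open>g i\<close>.
      Truncation in \<open>sum a UNIV - r\<close> can only occur where
      \<open>v (p, a) = 0\<close>.\<close>
    define \<phi> where "\<phi> t = (\<Sum>(p, a)\<in>P \<times> exponents N. v (p, a) * (e p (p0 + t *\<^sub>R y) *
        (\<Prod>i\<in>UNIV. (g i (p0 + t *\<^sub>R y) / t) ^ a i)) * t ^ (sum a UNIV - r))" for t
    have "((\<lambda>t. e p (p0 + t *\<^sub>R y)) \<longlongrightarrow> e p p0) (at 0)" for p
      using cont[of p] by (intro isCont_tendsto_compose[of _ "e p"]) (auto intro!: tendsto_eq_intros)
    moreover have "((\<lambda>t. g i (p0 + t *\<^sub>R y) / t) \<longlongrightarrow> vec_nth (g' y) i) (at 0)" for i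
      by (rule directional_limit[OF gi]) (simp add: zero p0)
    ultimately have lim: "(\<phi> \<longlongrightarrow> (\<Sum>(p, a)\<in>P \<times> exponents N. v (p, a) *
        (e p p0 * (\<Prod>i\<in>UNIV. vec_nth (g' y) i ^ a i)) * 0 ^ (sum a UNIV - r))) (at 0)"
      unfolding \<phi>_def case_prod_unfold by (intro tendsto_intros)
    have "\<phi> t = 0" if "t \<noteq> 0" for t
    proof -
      have "v (p, a) * (e p (p0 + t *\<^sub>R y) * (\<Prod>i\<in>UNIV. (g i (p0 + t *\<^sub>R y) / t) ^ a i))
          * t ^ (sum a UNIV - r) =
          v (p, a) * (e p (p0 + t *\<^sub>R y) * (\<Prod>i\<in>UNIV. g i (p0 + t *\<^sub>R y) ^ a i)) / t ^ r"
        if "p \<in> P" "a \<in> exponents N" for p a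
      proof (cases "v (p, a) = 0")
        case False
        then have "r \<le> sum a UNIV" using minimal that r_def by simp
        then have "t ^ sum a UNIV = t ^ (sum a UNIV - r) * t ^ r"
          by (simp flip: power_add)
        then show ?thesis using \<open>t \<noteq> 0\<close>
          by (simp add: power_divide prod_dividef power_sum field_simps)
      qed simp
      then have "\<phi> t = (\<Sum>(p, a)\<in>P \<times> exponents N. v (p, a) *
          (e p (p0 + t *\<^sub>R y) * (\<Prod>i\<in>UNIV. g i (p0 + t *\<^sub>R y) ^ a i)) / t ^ r)"
        unfolding \<phi>_def by (intro sum.cong) auto
      also have "\<dots> = 0" using rel[of "p0 + t *\<^sub>R y"]
        by (simp add: case_prod_unfold flip: sum_divide_distrib)
      finally show ?thesis .
    qed
    then have "(\<phi> \<longlongrightarrow> 0) (at 0)"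
      by (intro tendsto_eventually) (auto simp: eventually_at_filter)
    from tendsto_unique[OF _ lim this] show ?thesis by simp
  qed
  \<comment> \<open>Surjectivity of \<open>g'\<close> makes \<open>z\<close> arbitrary, the values
    of \<open>e\<close> at \<open>p0\<close> select \<open>p = p0\<close>, and the power of 0
    removes all terms of degree above \<open>r\<close>.\<close>
  have "(\<Sum>a\<in>exponents N. v (p0, a) * 0 ^ (sum a UNIV - r) * (\<Prod>i\<in>UNIV. z i ^ a i)) = 0"
    for z :: "'k \<Rightarrow> real"
  proof -
    obtain y where y: "g' y = (\<chi> i. z i)" using g'(2) by (metis surjD)
    have "0 = (\<Sum>p\<in>P. \<Sum>a\<in>exponents N. v (p, a) * (e p p0 * (\<Prod>i\<in>UNIV. z i ^ a i))
      * 0 ^ (sum a UNIV - r))"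
      using lim_zero[of y] by (simp add: y sum.cartesian_product)
    also have "\<dots> = (\<Sum>p\<in>P. if p = p0 then \<Sum>a\<in>exponents N. v (p, a) * (\<Prod>i\<in>UNIV. z i ^ a i)
      * 0 ^ (sum a UNIV - r) else 0)"
      by (intro sum.cong) (auto simp: e)
    finally show ?thesis using assms(1) p0(1) by (simp add: mult_ac)
  qed
  \<comment> \<open>At \<open>a0\<close> the extra factor is \<open>0 ^ 0 = 1\<close>, so the
    vanishing coefficient is \<open>v (p0, a0)\<close> itself.\<close>
  from multivariate_coeffs_eq_0[OF finite p0(2) this] show False
    using p0(3) by (simp add: r_def)
qed

text \<open>The products of a Lagrange function with a monomial in the \<open>g i\<close> of
  exponents up to \<open>N\<close> are independent, so they cannot outnumber the monomials of
  exponents up to \<open>T\<close>.\<close>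

lemma card_nondegenerate_zeros:
  fixes g :: "'k::finite \<Rightarrow> real ^ 'k \<Rightarrow> real" and P :: "(real ^ 'k) set"
  assumes "finite P" and g: "\<And>i. polyf D (g i)"
    and zero: "\<And>p i. p \<in> P \<Longrightarrow> g i p = 0"
    and deriv: "\<And>p. p \<in> P \<Longrightarrow> \<exists>g'. ((\<lambda>x. \<chi> i. g i x) has_derivative g') (at p) \<and> surj g'"
  shows "card P \<le> (CARD('k) * D + 1) ^ CARD('k)"
proof -
  define N where "N = card P"
  \<comment> \<open>\<open>e p\<close> contributes \<open>N\<close>, and each of the
    \<open>CARD('k)\<close> powers \<open>g i ^ a i\<close> at most \<open>N * D\<close>.\<close>
  define T where "T = N + CARD('k) * (N * D)"
  let ?I = "P \<times> (exponents N :: ('k \<Rightarrow> nat) set)"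
  note fin = finite_exponents[where 'k = 'k]
  have "\<exists>e. polyf N e \<and> (p \<in> P \<longrightarrow> e p = 1 \<and> (\<forall>q\<in>P - {p}. e q = 0))" for p
    using lagrange_polyf[OF assms(1), of p] polyf.const unfolding N_def by (cases "p \<in> P") blast+
  then obtain e where e: "\<And>p. polyf N (e p)"
    "\<And>p. p \<in> P \<Longrightarrow> e p p = 1" "\<And>p q. p \<in> P \<Longrightarrow> q \<in> P - {p} \<Longrightarrow> e p q = 0"
    by metis
  have "polyf T (\<lambda>x. e p x * (\<Prod>i\<in>UNIV. g i x ^ a i))" if "a \<in> exponents N" for p a
  proof -
    have "polyf (N + (\<Sum>i\<in>UNIV. a i * D)) (\<lambda>x. e p x * (\<Prod>i\<in>UNIV. g i x ^ a i))"
      by (intro polyf.mult e polyf_prod polyf_power g finite)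
    moreover have "(\<Sum>i\<in>UNIV. a i * D) \<le> (\<Sum>i\<in>(UNIV::'k set). N * D)"
      using that by (intro sum_mono mult_right_mono) auto
    ultimately show ?thesis by (auto simp: T_def elim: polyf.mono)
  qed
  then have "\<forall>pa\<in>?I. \<exists>c. \<forall>x. e (fst pa) x * (\<Prod>i\<in>UNIV. g i x ^ snd pa i) =
      (\<Sum>b\<in>exponents T. c b * (\<Prod>i\<in>UNIV. vec_nth x i ^ b i))"
    by (intro ballI polyf_coeffs) auto
  from bchoice[OF this] obtain c where
    "\<forall>pa\<in>?I. \<forall>x. e (fst pa) x * (\<Prod>i\<in>UNIV. g i x ^ snd pa i) =
      (\<Sum>b\<in>exponents T. c pa b * (\<Prod>i\<in>UNIV. vec_nth x i ^ b i))" ..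
  then have c: "e p x * (\<Prod>i\<in>UNIV. g i x ^ a i) =
      (\<Sum>b\<in>exponents T. c (p, a) b * (\<Prod>i\<in>UNIV. vec_nth x i ^ b i))" if "(p, a) \<in> ?I" for p a x
    using that by force
  have "card ?I \<le> card (exponents T :: ('k \<Rightarrow> nat) set)"
  proof (rule ccontr)
    assume "\<not> ?thesis"
    then obtain v pa where v: "pa \<in> ?I" "v pa \<noteq> 0"
        "\<And>b. b \<in> exponents T \<Longrightarrow> (\<Sum>pa\<in>?I. v pa * c pa b) = 0"
      using underdetermined_system[of "exponents T" ?I c] fin assms(1) by (auto simp: not_le)
    \<comment> \<open>Among the pairs with non-zero coefficient, one of least total degree is
      singled out.\<close>
    obtain p0 a0 where p0: "(p0, a0) \<in> ?I \<and> v (p0, a0) \<noteq> 0"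
      and min: "\<And>p a. (p, a) \<in> ?I \<Longrightarrow> v (p, a) \<noteq> 0 \<Longrightarrow> sum a0 UNIV \<le> sum a UNIV"
      using ex_has_least_nat[of "\<lambda>pa. pa \<in> ?I \<and> v pa \<noteq> 0" pa "\<lambda>pa. sum (snd pa) UNIV"] v
      by (metis (no_types, lifting) prod.collapse snd_conv)
    have rel: "(\<Sum>(p, a)\<in>?I. v (p, a) * (e p x * (\<Prod>i\<in>UNIV. g i x ^ a i))) = 0" for x
    proof -
      have "(\<Sum>(p, a)\<in>?I. v (p, a) * (e p x * (\<Prod>i\<in>UNIV. g i x ^ a i))) =
          (\<Sum>pa\<in>?I. \<Sum>b\<in>exponents T. v pa * c pa b * (\<Prod>i\<in>UNIV. vec_nth x i ^ b i))"
        by (intro sum.cong) (auto simp: c sum_distrib_left mult.assoc)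
      also have "\<dots> = (\<Sum>b\<in>exponents T. (\<Sum>pa\<in>?I. v pa * c pa b) * (\<Prod>i\<in>UNIV. vec_nth x i ^ b i))"
        by (subst sum.swap) (simp add: sum_distrib_right)
      also have "\<dots> = 0" using v(3) by simp
      finally show ?thesis .
    qed
    show False
    proof (rule independent_at_nondegenerate_zeros[OF assms(1) zero deriv])
      show "isCont (e p) p0" for p
        using polyf_has_derivative[OF e(1)] has_derivative_continuous by blast
      show "e p p0 = (if p = p0 then 1 else 0)" if "p \<in> P" for p
        using e(2,3) that p0 by auto
      show "p0 \<in> P" "a0 \<in> exponents N" "v (p0, a0) \<noteq> 0"
        using p0 by auto
      show "sum a0 UNIV \<le> sum a UNIV" if "p \<in> P" "a \<in> exponents N" "v (p, a) \<noteq> 0" for p a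
        using min that by auto
    qed (assumption | rule rel)+
  qed
  then have "N * (N + 1) ^ CARD('k) \<le> (T + 1) ^ CARD('k)"
    by (simp add: card_cartesian_product card_exponents N_def)
  \<comment> \<open>Exponents up to \<open>N\<close> are enough to absorb the degree of
    \<open>e p\<close>: the factor \<open>(N + 1) ^ CARD('k)\<close> appears on both sides and
    cancels, leaving a bound on \<open>N\<close>.\<close>
  also have "\<dots> \<le> ((CARD('k) * D + 1) * (N + 1)) ^ CARD('k)"
    by (intro power_mono) (auto simp: T_def algebra_simps)
  also have "\<dots> = (CARD('k) * D + 1) ^ CARD('k) * (N + 1) ^ CARD('k)"
    by (simp only: power_mult_distrib)
  finally show ?thesis
    unfolding N_def by (rule mult_right_le_imp_le) simp
qed

subsection \<open>Counting sign vectors of polynomials\<close>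

text \<open>By Sard's theorem the critical values form a null set, which cannot be the whole
  space.\<close>

lemma exists_regular_value:
  fixes G :: "real ^ 'k::{finite,wellorder} \<Rightarrow> real ^ 'k::{finite,wellorder}"
  assumes "\<And>x. x \<in> W \<Longrightarrow> (G has_derivative G' x) (at x)"
  shows "\<exists>u. \<forall>x\<in>W. G x = u \<longrightarrow> surj (G' x)"
proof -
  let ?S = "{x \<in> W. \<not> surj (G' x)}"
  have "negligible (G ` ?S)"
  proof (rule baby_Sard)
    fix x assume x: "x \<in> ?S"
    then show "(G has_derivative G' x) (at x within ?S)"
      using assms has_derivative_at_withinI by blast
    have "linear (G' x)" using assms x has_derivative_linear by blast
    moreover from this have "\<not> inj (G' x)"
      using x linear_injective_imp_surjective by blast
    ultimately show "rank (matrix (G' x)) < CARD('k)"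
      by (simp add: less_rank_noninjective)
  qed simp
  then have "G ` ?S \<noteq> UNIV" by auto
  then obtain u where "u \<notin> G ` ?S" by blast
  then show ?thesis by (intro exI[of _ u]) auto
qed

text \<open>Inside a large ball, \<open>\<bar>F x\<bar> exp (- u \<bullet> x)\<close> with \<open>F\<close> the product of all polynomials (and of
  the equation of the sphere) attains its maximum over each closed sign cell in the open cell. There
  \<open>\<nabla>F = F u\<close>, and by Sard these critical points are nondegenerate for suitable \<open>u\<close>.\<close>

lemma card_sign_vectors:
  fixes f :: "'j \<Rightarrow> real ^ 'k::{finite,wellorder} \<Rightarrow> real"
  assumes I: "finite I" and f: "\<And>j. j \<in> I \<Longrightarrow> polyf d (f j)" and d: "2 \<le> d"
    and X: "finite X" and nz: "\<And>x j. x \<in> X \<Longrightarrow> j \<in> I \<Longrightarrow> f j x \<noteq> 0"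
    and inj: "\<And>x y. x \<in> X \<Longrightarrow> y \<in> X \<Longrightarrow> (\<And>j. j \<in> I \<Longrightarrow> sgn (f j x) = sgn (f j y)) \<Longrightarrow> x = y"
  shows "card X \<le> (CARD('k) * ((card I + 1) * d) + 1) ^ CARD('k)"
proof -
  \<comment> \<open>The degrees of the \<open>card I\<close> polynomials plus that of the sphere
    equation, whose degree 2 is covered by \<open>d\<close>.\<close>
  define D where "D = (card I + 1) * d"
  obtain R where R: "\<And>x. x \<in> X \<Longrightarrow> norm x < R"
    using bounded_pos_less[of X] finite_imp_bounded[OF X] by blast
  define q where "q x = R\<^sup>2 - inner x x" for x :: "real ^ 'k::{finite,wellorder}"
  have qX: "q x > 0" if "x \<in> X" for x
    using R[OF that] by (simp add: q_def dot_square_norm power_strict_mono)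
  have "polyf 2 q" unfolding q_def inner_vec_def inner_real_def
    using polyf.mult[OF polyf.coord polyf.coord]
    by (intro polyf_diff polyf.const polyf_sum) (auto simp: numeral_2_eq_2)
  then have q: "polyf d q" using d by (rule polyf.mono)
  define F where "F x = q x * (\<Prod>j\<in>I. f j x)" for x
  have "polyf (d + (\<Sum>j\<in>I. d)) F" unfolding F_def
    by (intro polyf.mult q polyf_prod I f)
  then have F: "polyf D F" by (simp add: D_def)
  obtain F1 where F1: "\<And>i. polyf D (F1 i)"
    "\<And>x. (F has_derivative (\<lambda>h. \<Sum>i\<in>UNIV. F1 i x * vec_nth h i)) (at x)"
    using polyf_has_derivative[OF F] by blast
  obtain F2 where F2:
    "\<And>i x. (F1 i has_derivative (\<lambda>h. \<Sum>j\<in>UNIV. F2 i j x * vec_nth h j)) (at x)"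
    using polyf_has_derivative[OF F1(1)] by metis
  define W where "W = {x. F x \<noteq> 0}"
  \<comment> \<open>The gradient of \<open>ln \<bar>F x\<bar>\<close>. A solution of
    \<open>G x = u\<close> is a critical point of
    \<open>\<bar>F x\<bar> exp (- u \<bullet> x)\<close>.\<close>
  define G where "G x = (\<chi> i. F1 i x / F x)" for x
  define G' where "G' x h = (\<chi> i. ((\<Sum>j\<in>UNIV. F2 i j x * vec_nth h j) * F x
      - F1 i x * (\<Sum>j\<in>UNIV. F1 j x * vec_nth h j)) / (F x * F x))" for x h
  have "(G has_derivative G' x) (at x)" if "x \<in> W" for x
  proof -
    have "((\<lambda>x. vec_nth (G x) i) has_derivative (\<lambda>h. vec_nth (G' x h) i)) (at x)" for i
      unfolding G_def G'_def vec_lambda_beta using that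
      by (intro has_derivative_divide' F1 F2) (simp add: W_def)
    then show ?thesis
      by (subst has_derivative_componentwise_within) (auto simp: Basis_vec_def inner_axis)
  qed
  from exists_regular_value[OF this] obtain u
    where u: "\<forall>x\<in>W. G x = u \<longrightarrow> surj (G' x)" ..
  have "\<exists>z. F z \<noteq> 0 \<and> (\<forall>j\<in>I. sgn (f j z) = sgn (f j x)) \<and> (\<forall>i. F1 i z = vec_nth u i * F z)"
    if x: "x \<in> X" for x
  proof -
    have cont: "continuous_on A g" if "polyf T g" for T and g :: "real ^ 'k::{finite,wellorder} \<Rightarrow> real" and A
      using polyf_has_derivative[OF that] has_derivative_continuous
      by (meson continuous_at_imp_continuous_on)
    \<comment> \<open>Closed and open versions of the sign cell of \<open>x\<close> inside the ball;
      the factor \<open>F x\<close> below makes \<open>\<Psi>\<close> positive at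
      \<open>x\<close>.\<close>
    define C where "C = {y. 0 \<le> q y} \<inter> (\<Inter>j\<in>I. {y. 0 \<le> f j y * f j x})"
    define U where "U = {y. 0 < q y} \<inter> (\<Inter>j\<in>I. {y. 0 < f j y * f j x})"
    define \<Psi> where "\<Psi> y = F y * F x * exp (- inner u y)" for y
    have "closed C" unfolding C_def
      by (intro closed_Int closed_INT ballI closed_Collect_le continuous_intros cont[OF q] cont[OF f])
    moreover have "C \<subseteq> cball 0 \<bar>R\<bar>"
      by (auto simp: C_def q_def dot_square_norm abs_le_square_iff[of "norm _", simplified])
    ultimately have "compact C"
      by (meson bounded_cball bounded_subset compact_eq_bounded_closed)
    moreover have "x \<in> C" using x qX[of x] by (auto simp: C_def)
    moreover have "continuous_on C \<Psi>" unfolding \<Psi>_def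
      by (intro continuous_intros cont[OF F])
    ultimately obtain z where z: "z \<in> C" "\<And>y. y \<in> C \<Longrightarrow> \<Psi> y \<le> \<Psi> z"
      using continuous_attains_sup[of C \<Psi>] by blast
    have "F x \<noteq> 0" using x qX[of x] nz I by (auto simp: F_def)
    then have "0 < \<Psi> x" by (auto simp: \<Psi>_def zero_less_mult_iff)
    then have "\<Psi> z > 0" using z(2)[OF \<open>x \<in> C\<close>] by linarith
    then have Fz: "F z \<noteq> 0" by (auto simp: \<Psi>_def)
    then have "q z \<noteq> 0" "\<And>j. j \<in> I \<Longrightarrow> f j z \<noteq> 0" using I by (auto simp: F_def)
    \<comment> \<open>A positive maximum forces every factor of \<open>F z\<close> to be non-zero,
      so the weak inequalities of \<open>C\<close> are strict at \<open>z\<close> and the maximum is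
      interior.\<close>
    then have "z \<in> U" using z(1) nz[OF x] by (force simp: C_def U_def less_le)
    have "open U" unfolding U_def using I
      by (intro open_Int open_INT ballI open_Collect_less continuous_intros cont[OF q] cont[OF f])
    have "U \<subseteq> C" by (auto simp: U_def C_def less_imp_le)
    define \<Psi>' where "\<Psi>' h = F x * exp (- inner u z) *
      ((\<Sum>i\<in>UNIV. F1 i z * vec_nth h i) - F z * inner u h)" for h
    have "(\<Psi> has_derivative \<Psi>') (at z)" unfolding \<Psi>_def \<Psi>'_def
      by (auto intro!: derivative_eq_intros F1 simp: algebra_simps)
    from differential_zero_maxmin[OF \<open>z \<in> U\<close> \<open>open U\<close> this] z(2) \<open>U \<subseteq> C\<close>
    have "\<Psi>' = (\<lambda>h. 0)" by blast
    then have "(\<Sum>j\<in>UNIV. F1 j z * vec_nth h j) = F z * inner u h" for h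
      using \<open>F x \<noteq> 0\<close> by (auto simp: \<Psi>'_def fun_eq_iff)
    from this[of "axis _ 1"] have "F1 i z = vec_nth u i * F z" for i
      by (simp add: axis_def inner_vec_def if_distrib[of "\<lambda>y. _ * y"] cong: if_cong)
    moreover have "sgn (f j z) = sgn (f j x)" if "j \<in> I" for j
      using \<open>z \<in> U\<close> that by (auto simp: U_def sgn_if zero_less_mult_iff)
    ultimately show ?thesis using Fz by blast
  qed
  then obtain \<zeta> where \<zeta>: "\<And>x. x \<in> X \<Longrightarrow> F (\<zeta> x) \<noteq> 0"
    "\<And>x j. x \<in> X \<Longrightarrow> j \<in> I \<Longrightarrow> sgn (f j (\<zeta> x)) = sgn (f j x)"
    "\<And>x i. x \<in> X \<Longrightarrow> F1 i (\<zeta> x) = vec_nth u i * F (\<zeta> x)"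
    by metis
  \<comment> \<open>The equation \<open>G x = u\<close> with its denominator cleared: a polynomial
    system with one equation per unknown.\<close>
  define g where "g i x = F1 i x - vec_nth u i * F x" for i x
  have "card (\<zeta> ` X) \<le> (CARD('k) * D + 1) ^ CARD('k)"
  proof (rule card_nondegenerate_zeros)
    show "finite (\<zeta> ` X)" using X by simp
    show "polyf D (g i)" for i unfolding g_def
      by (intro polyf_diff polyf_cmult F F1)
    fix p assume "p \<in> \<zeta> ` X"
    then have p: "F p \<noteq> 0" "\<And>i. F1 i p = vec_nth u i * F p" using \<zeta> by auto
    show "g i p = 0" for i by (simp add: g_def p)
    define g' where "g' h = (\<chi> i. (\<Sum>j\<in>UNIV. F2 i j p * vec_nth h j)
        - vec_nth u i * (\<Sum>j\<in>UNIV. F1 j p * vec_nth h j))" for h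
    have "((\<lambda>x. g i x) has_derivative (\<lambda>h. vec_nth (g' h) i)) (at p)" for i
      unfolding g_def g'_def vec_lambda_beta
      by (intro has_derivative_diff has_derivative_mult_right F1 F2)
    then have "((\<lambda>x. \<chi> i. g i x) has_derivative g') (at p)"
      by (subst has_derivative_componentwise_within) (auto simp: Basis_vec_def inner_axis)
    moreover have "surj g'"
    proof -
      have "surj (G' p)" using p by (intro u[rule_format]) (auto simp: W_def G_def Finite_Cartesian_Product.vec_eq_iff)
      \<comment> \<open>At a zero of \<open>g\<close>, clearing the denominator only scales the
        derivative by \<open>F p\<close>, so nondegeneracy carries over from
        \<open>G\<close>.\<close>
      moreover have "g' h = F p *\<^sub>R G' p h" for h
        using p(1) by (simp add: g'_def G'_def Finite_Cartesian_Product.vec_eq_iff p(2) field_simps)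
      then have "g' = (\<lambda>y. F p *\<^sub>R y) \<circ> G' p" by auto
      moreover have "surj (\<lambda>y :: real ^ 'k::{finite,wellorder}. F p *\<^sub>R y)"
        using p(1) by (intro surjI[of _ "\<lambda>y. inverse (F p) *\<^sub>R y"]) simp
      ultimately show ?thesis by (metis comp_surj)
    qed
    ultimately show "\<exists>g'. ((\<lambda>x. \<chi> i. g i x) has_derivative g') (at p) \<and> surj g'" by blast
  qed
  \<comment> \<open>\<open>\<zeta> x\<close> lies in the sign cell of \<open>x\<close>, and distinct
    points of \<open>X\<close> lie in distinct cells.\<close>
  moreover have "inj_on \<zeta> X" using inj \<zeta>(2) by (intro inj_onI) metis
  ultimately show ?thesis by (simp add: card_image D_def)
qed

subsection \<open>Representable sign patterns of a fixed size\<close>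

text \<open>Coordinates on the symmetric matrices: \<open>min\<close> and \<open>max\<close> build
  in the symmetry, and \<open>idx\<close> assigns matrix positions to coordinates.\<close>

definition sym_mat :: "nat \<Rightarrow> (nat \<Rightarrow> nat \<Rightarrow> 'k) \<Rightarrow> real ^ 'k \<Rightarrow> real mat" where
  "sym_mat n idx x = mat n n (\<lambda>(i, j). vec_nth x (idx (min i j) (max i j)))"

text \<open>Each term of the Leibniz formula is a product of at most \<open>n\<close>
  coordinates.\<close>

lemma polyf_principal_minor_sym_mat: "polyf n (\<lambda>x. principal_minor (sym_mat n idx x) K)"
proof -
  define r where "r = card {i. i < n \<and> i \<in> K}"
  define k where "k i j = idx (min (pick K i) (pick K j)) (max (pick K i) (pick K j))" for i j
  have "r \<le> card {..<n}" unfolding r_def by (intro card_mono) auto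
  then have "r \<le> n" by simp
  have "principal_minor (sym_mat n idx x) K =
      (\<Sum>p | p permutes {0..<r}. signof p * (\<Prod>i\<in>{0..<r}. vec_nth x (k i (p i))))" for x
  proof -
    have carrier: "submatrix (sym_mat n idx x) K K \<in> carrier_mat r r"
      by (intro carrier_matI) (simp_all add: dim_submatrix r_def sym_mat_def)
    have "submatrix (sym_mat n idx x) K K $$ (i, p i) = vec_nth x (k i (p i))"
      if "p permutes {0..<r}" "i \<in> {0..<r}" for p i
    proof -
      have "i < r" "p i < r" using that permutes_in_image[OF that(1)] by auto
      moreover from this have "pick K i < n" "pick K (p i) < n" unfolding r_def by (auto intro: pick_le)
      ultimately show ?thesis
        by (simp add: submatrix_index sym_mat_def r_def k_def)
    qed
    then show ?thesis unfolding principal_minor_def det_def'[OF carrier]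
      by (intro sum.cong prod.cong arg_cong2[of _ _ _ _ times]) auto
  qed
  moreover have "polyf n (\<lambda>x. \<Sum>p | p permutes {0..<r}. signof p * (\<Prod>i\<in>{0..<r}. vec_nth x (k i (p i))))"
  proof (intro polyf_sum polyf_cmult finite_permutations)
    fix p
    have "polyf (\<Sum>i\<in>{0..<r}. 1) (\<lambda>x. \<Prod>i\<in>{0..<r}. vec_nth x (k i (p i)))"
      by (intro polyf_prod polyf.coord) auto
    then show "polyf n (\<lambda>x. \<Prod>i\<in>{0..<r}. vec_nth x (k i (p i)))"
      by (rule polyf.mono) (use \<open>r \<le> n\<close> in simp)
  qed simp
  ultimately show ?thesis by presburger
qed

text \<open>Injectivity of \<open>idx\<close> allows the entries on and above the diagonal to be
  prescribed independently.\<close>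

lemma sym_mat_surj:
  assumes "inj_on (\<lambda>(i, j). idx i j) ({..<n} \<times> {..<n})" "A \<in> carrier_mat n n" "transpose_mat A = A"
  shows "\<exists>x. sym_mat n idx x = A"
proof -
  define pos where "pos = inv_into ({..<n} \<times> {..<n}) (\<lambda>(i, j). idx i j)"
  have pos: "pos (idx i j) = (i, j)" if "i < n" "j < n" for i j
    using inv_into_f_f[OF assms(1), of "(i, j)"] that by (simp add: pos_def)
  have "A $$ (min i j, max i j) = A $$ (i, j)" if "i < n" "j < n" for i j
  proof -
    have "A $$ (j, i) = transpose_mat A $$ (i, j)" using assms(2) that by simp
    then show ?thesis unfolding assms(3) by (auto simp: min_def max_def)
  qed
  then have "sym_mat n idx (\<chi> k. A $$ pos k) = A"
    using assms(2) by (intro eq_matI) (auto simp: sym_mat_def pos)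
  then show ?thesis by blast
qed

lemma finite_representable: "finite {s. representable n s}"
proof (rule finite_subset)
  show "{s. representable n s} \<subseteq> sign_patterns n"
    by (auto simp: representable_def)
  show "finite (sign_patterns n)"
    unfolding sign_patterns_def by (intro finite_PiE) auto
qed

lemma sign_patterns_eqI:
  assumes "s \<in> sign_patterns n" "t \<in> sign_patterns n" "\<And>K. K \<subseteq> {..<n} \<Longrightarrow> s K = t K"
  shows "s = t"
  using assms unfolding sign_patterns_def by (intro PiE_ext[of s _ _ t]) auto

text \<open>One representing point is chosen for each pattern; the signs of the \<open>2 ^ n\<close>
  principal minors, polynomials with degree bound \<open>n\<close>, tell these points apart.\<close>

lemma card_representable_le:
  fixes idx :: "nat \<Rightarrow> nat \<Rightarrow> 'k::{finite,wellorder}"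
  assumes "inj_on (\<lambda>(i, j). idx i j) ({..<n} \<times> {..<n})" "2 \<le> n"
  shows "card {s. representable n s} \<le> (CARD('k) * ((2 ^ n + 1) * n) + 1) ^ CARD('k)"
proof -
  let ?R = "{s. representable n s}"
  let ?f = "\<lambda>K x. principal_minor (sym_mat n idx x) K"
  have "\<exists>x. \<forall>K\<subseteq>{..<n}. ?f K x \<noteq> 0 \<and> s K = sgn (?f K x)" if "s \<in> ?R" for s
    using that sym_mat_surj[OF assms(1)] unfolding representable_def by blast
  then obtain \<xi> where \<xi>: "\<And>s K. s \<in> ?R \<Longrightarrow> K \<subseteq> {..<n} \<Longrightarrow> ?f K (\<xi> s) \<noteq> 0"
    "\<And>s K. s \<in> ?R \<Longrightarrow> K \<subseteq> {..<n} \<Longrightarrow> s K = sgn (?f K (\<xi> s))"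
    by metis
  have eq: "s = t" if "s \<in> ?R" "t \<in> ?R" "\<And>K. K \<subseteq> {..<n} \<Longrightarrow> sgn (?f K (\<xi> s)) = sgn (?f K (\<xi> t))" for s t
    using that \<xi>(2) by (intro sign_patterns_eqI[of s n t]) (auto simp: representable_def)
  have "card (\<xi> ` ?R) \<le> (CARD('k) * ((card (Pow {..<n}) + 1) * n) + 1) ^ CARD('k)"
  proof (rule card_sign_vectors[where f = ?f])
    fix x y assume "x \<in> \<xi> ` ?R" "y \<in> \<xi> ` ?R" and *: "\<And>K. K \<in> Pow {..<n} \<Longrightarrow> sgn (?f K x) = sgn (?f K y)"
    then obtain s t where "x = \<xi> s" "y = \<xi> t" "s \<in> ?R" "t \<in> ?R" by blast
    with eq[of s t] * show "x = y" by simp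
  qed (use \<xi>(1) assms(2) finite_representable in \<open>auto simp: polyf_principal_minor_sym_mat\<close>)
  moreover have "inj_on \<xi> ?R" using eq by (intro inj_onI) auto
  ultimately show ?thesis by (simp add: card_image card_Pow)
qed

subsection \<open>Deletion and contraction\<close>

lemma pick_eq_pick_Int:
  assumes "i < card {a. a < n \<and> a \<in> I}" "{a. a < n \<and> a \<in> I} = {a. a < n \<and> a \<in> J}"
  shows "pick I i = pick J i"
  using pick_reduce_set[of i n I] pick_reduce_set[of i n J] assms by simp

definition schur :: "nat \<Rightarrow> real mat \<Rightarrow> real mat" where
  "schur n A = mat n n (\<lambda>(i, j). A $$ (i, j) - A $$ (i, n) * A $$ (n, j) / A $$ (n, n))"

text \<open>Pivoting on the last diagonal entry writes the submatrix as a product of two block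
  triangular matrices, whose determinants are read off the diagonal blocks.\<close>

lemma principal_minor_schur:
  assumes A: "A \<in> carrier_mat (Suc n) (Suc n)" and d: "A $$ (n, n) \<noteq> 0" and K: "K \<subseteq> {..<n}"
  shows "principal_minor A (insert n K) = A $$ (n, n) * principal_minor (schur n A) K"
proof -
  define r where "r = card K"
  have "finite K" using K finite_subset by blast
  have K1: "{a. a < n \<and> a \<in> insert n K} = K" "{a. a < n \<and> a \<in> K} = K"
    and K2: "{a. a < Suc n \<and> (a = n \<or> a \<in> K)} = insert n K" and "n \<notin> K"
    using K by auto
  have "{a \<in> insert n K. a < n} = K" using K by auto
  \<comment> \<open>\<open>n\<close> is the largest element of \<open>insert n K\<close>, so it
    takes the last index \<open>r\<close>.\<close>
  then have pick_r: "pick (insert n K) r = n"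
    using pick_card_in_set[of n "insert n K"] by (simp add: r_def)
  have pick_less: "pick (insert n K) i = pick K i" "pick K i < n" if "i < r" for i
    using that pick_eq_pick_Int[of i n "insert n K" K] pick_le[of i n K] unfolding K1 r_def by blast+
  have card: "card (insert n K) = Suc r" using \<open>finite K\<close> \<open>n \<notin> K\<close> by (simp add: r_def)
  define P where "P = submatrix (schur n A) K K"
  define b where "b = mat r 1 (\<lambda>(i, j). A $$ (pick K i, n))"
  define c where "c = mat 1 r (\<lambda>(i, j). A $$ (n, pick K j) / A $$ (n, n))"
  define D where "D = mat 1 1 (\<lambda>(i, j). A $$ (n, n))"
  have P: "P \<in> carrier_mat r r"
    by (intro carrier_matI) (simp_all add: P_def dim_submatrix schur_def K1 r_def)
  have b: "b \<in> carrier_mat r 1" and c: "c \<in> carrier_mat 1 r" and D: "D \<in> carrier_mat 1 1"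
    by (simp_all add: b_def c_def D_def)
  \<comment> \<open>\<open>b\<close> is the last column and \<open>D * c\<close> the last row,
    \<open>c\<close> having been divided by the pivot; adding \<open>b * c\<close> to
    \<open>P\<close> undoes the Schur complement.\<close>
  have "submatrix A (insert n K) (insert n K) = four_block_mat (P + b * c) b (D * c) D"
  proof (rule eq_matI)
    show "dim_row (submatrix A (insert n K) (insert n K)) = dim_row (four_block_mat (P + b * c) b (D * c) D)"
      "dim_col (submatrix A (insert n K) (insert n K)) = dim_col (four_block_mat (P + b * c) b (D * c) D)"
      using A P b c D by (simp_all add: dim_submatrix K2 card)
    fix i j
    assume "i < dim_row (four_block_mat (P + b * c) b (D * c) D)"
      "j < dim_col (four_block_mat (P + b * c) b (D * c) D)"
    then have ij: "i < Suc r" "j < Suc r" using P b c D by simp_all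
    have lhs: "submatrix A (insert n K) (insert n K) $$ (i, j) =
        A $$ (pick (insert n K) i, pick (insert n K) j)"
      using A ij by (intro submatrix_index) (simp_all add: K2 card)
    have Pij: "P $$ (i, j) = A $$ (pick K i, pick K j)
        - A $$ (pick K i, n) * A $$ (n, pick K j) / A $$ (n, n)" if "i < r" "j < r"
    proof -
      have "P $$ (i, j) = schur n A $$ (pick K i, pick K j)"
        unfolding P_def using that by (intro submatrix_index) (simp_all add: schur_def K1 r_def)
      then show ?thesis using that by (simp add: schur_def pick_less)
    qed
    show "submatrix A (insert n K) (insert n K) $$ (i, j) = four_block_mat (P + b * c) b (D * c) D $$ (i, j)"
      unfolding lhs using ij P b c D d Pij
      by (cases "i < r"; cases "j < r")
        (auto simp: less_Suc_eq pick_less pick_r scalar_prod_def b_def c_def D_def)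
  qed
  also have "\<dots> = four_block_mat P b (0\<^sub>m 1 r) D * four_block_mat (1\<^sub>m r) (0\<^sub>m r 1) c (1\<^sub>m 1)"
    using P b c D
    by (subst mult_four_block_mat[of _ r r _ 1 _ 1 _ _ r _ 1]) auto
  finally have "principal_minor A (insert n K) =
      det (four_block_mat P b (0\<^sub>m 1 r) D * four_block_mat (1\<^sub>m r) (0\<^sub>m r 1) c (1\<^sub>m 1))"
    by (simp add: principal_minor_def)
  also have "\<dots> = det (four_block_mat P b (0\<^sub>m 1 r) D) * det (four_block_mat (1\<^sub>m r) (0\<^sub>m r 1) c (1\<^sub>m 1))"
    using P b c D by (intro det_mult[of _ "r + 1"]) auto
  also have "det (four_block_mat P b (0\<^sub>m 1 r) D) = det P * det D"
    using P b D by (intro det_four_block_mat_lower_left_zero) auto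
  also have "det (four_block_mat (1\<^sub>m r) (0\<^sub>m r 1) c (1\<^sub>m 1)) = 1"
    using c by (subst det_four_block_mat_upper_right_zero) auto
  also have "det D = A $$ (n, n)" using D by (simp add: det_single D_def)
  finally show ?thesis by (simp add: principal_minor_def P_def)
qed

lemma principal_minor_restrict:
  assumes A: "A \<in> carrier_mat (Suc n) (Suc n)" and K: "K \<subseteq> {..<n}"
  shows "principal_minor (mat n n (\<lambda>(i, j). A $$ (i, j))) K = principal_minor A K"
proof -
  have K1: "{a. a < n \<and> a \<in> K} = K" "{a. a < Suc n \<and> a \<in> K} = K" using K by auto
  have "submatrix (mat n n (\<lambda>(i, j). A $$ (i, j))) K K = submatrix A K K"
  proof (rule eq_matI)
    fix i j assume "i < dim_row (submatrix A K K)" "j < dim_col (submatrix A K K)"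
    then have ij: "i < card K" "j < card K" using A by (simp_all add: dim_submatrix K1)
    then have "pick K i < n" "pick K j < n" using pick_le[of _ n K] by (simp_all add: K1)
    then show "submatrix (mat n n (\<lambda>(i, j). A $$ (i, j))) K K $$ (i, j) = submatrix A K K $$ (i, j)"
      using A ij by (simp add: submatrix_index K1)
  qed (use A in \<open>simp_all add: dim_submatrix K1\<close>)
  then show ?thesis by (simp add: principal_minor_def)
qed

lemma representable_delete:
  assumes "representable (Suc n) s"
  shows "representable n (restrict s (Pow {..<n}))"
proof -
  obtain A where A: "A \<in> carrier_mat (Suc n) (Suc n)" "transpose_mat A = A"
    and minor: "\<And>K. K \<subseteq> {..<Suc n} \<Longrightarrow> principal_minor A K \<noteq> 0 \<and> s K = sgn (principal_minor A K)"
    using assms unfolding representable_def by blast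
  let ?B = "mat n n (\<lambda>(i, j). A $$ (i, j))"
  have "A $$ (j, i) = A $$ (i, j)" if "i < n" "j < n" for i j
    using A that by (metis carrier_matD index_transpose_mat(1) less_SucI)
  then have "transpose_mat ?B = ?B" by (intro eq_matI) auto
  moreover have "principal_minor ?B K \<noteq> 0 \<and> restrict s (Pow {..<n}) K = sgn (principal_minor ?B K)"
    if "K \<subseteq> {..<n}" for K
    using minor[of K] that unfolding principal_minor_restrict[OF A(1) that] by (auto simp: lessThan_Suc)
  moreover have "restrict s (Pow {..<n}) \<in> sign_patterns n"
    using assms unfolding representable_def sign_patterns_def
    by (auto simp: PiE_iff lessThan_Suc)
  ultimately show ?thesis unfolding representable_def by (intro conjI bexI[of _ ?B]) auto
qed

text \<open>The minors of the Schur complement are the minors of \<open>A\<close> containing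
  \<open>n\<close>, divided by the pivot. The pivot has sign \<open>s {n}\<close>, and dividing by a
  sign is multiplying by it.\<close>

lemma representable_contract:
  assumes "representable (Suc n) s"
  shows "representable n (\<lambda>K\<in>Pow {..<n}. s {n} * s (insert n K))"
proof -
  obtain A where A: "A \<in> carrier_mat (Suc n) (Suc n)" "transpose_mat A = A"
    and minor: "\<And>K. K \<subseteq> {..<Suc n} \<Longrightarrow> principal_minor A K \<noteq> 0 \<and> s K = sgn (principal_minor A K)"
    using assms unfolding representable_def by blast
  have eq: "{i. i < Suc n \<and> i = n} = {n}" by auto
  have "submatrix A {n} {n} \<in> carrier_mat 1 1"
    using A by (intro carrier_matI) (simp_all add: dim_submatrix eq)
  moreover have "submatrix A {n} {n} $$ (0, 0) = A $$ (pick {n} 0, pick {n} 0)"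
    using A by (intro submatrix_index) (simp_all add: eq)
  moreover have "pick {n} 0 = n" by (simp add: Least_equality)
  ultimately have "principal_minor A {n} = A $$ (n, n)"
    unfolding principal_minor_def using det_single by metis
  with minor[of "{n}"] have d: "A $$ (n, n) \<noteq> 0" "s {n} = sgn (A $$ (n, n))" by auto
  let ?B = "schur n A"
  have sym: "A $$ (j, i) = A $$ (i, j)" if "i < Suc n" "j < Suc n" for i j
    using A that by (metis carrier_matD index_transpose_mat(1))
  have "transpose_mat ?B = ?B" by (intro eq_matI) (auto simp: schur_def sym)
  moreover have "principal_minor ?B K \<noteq> 0 \<and> s {n} * s (insert n K) = sgn (principal_minor ?B K)"
    if "K \<subseteq> {..<n}" for K
  proof -
    have "insert n K \<subseteq> {..<Suc n}" using that by auto
    from minor[OF this] show ?thesis using d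
      by (auto simp: principal_minor_schur[OF A(1) d(1) that] sgn_mult)
  qed
  moreover have "(\<lambda>K\<in>Pow {..<n}. s {n} * s (insert n K)) \<in> sign_patterns n"
    using calculation(2) d by (auto simp: sign_patterns_def sgn_if)
  ultimately show ?thesis unfolding representable_def
    by (intro conjI bexI[of _ ?B]) (auto simp: schur_def)
qed

text \<open>A pattern is recovered from its deletion, its contraction and the sign of
  \<open>{n}\<close>. The factor 2 for that sign is placed on both sides so that the inequality
  iterates by plain squaring.\<close>

lemma card_representable_Suc:
  "2 * card {s. representable (Suc n) s} \<le> (2 * card {s. representable n s})\<^sup>2"
proof -
  let ?R = "\<lambda>n. {s. representable n s}"
  define \<Phi> where "\<Phi> s = (restrict s (Pow {..<n}), \<lambda>K\<in>Pow {..<n}. s {n} * s (insert n K), s {n})"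
    for s :: "nat set \<Rightarrow> real"
  have "inj_on \<Phi> (?R (Suc n))"
  proof (rule inj_onI)
    fix s t assume st: "s \<in> ?R (Suc n)" "t \<in> ?R (Suc n)" "\<Phi> s = \<Phi> t"
    then have pat: "s \<in> sign_patterns (Suc n)" "t \<in> sign_patterns (Suc n)"
      by (auto simp: representable_def)
    from st(3) have del: "\<And>K. K \<subseteq> {..<n} \<Longrightarrow> s K = t K"
      and con: "\<And>K. K \<subseteq> {..<n} \<Longrightarrow> s {n} * s (insert n K) = t {n} * t (insert n K)"
      and eq: "s {n} = t {n}"
      unfolding \<Phi>_def by (auto simp: fun_eq_iff restrict_def split: if_splits)
    have "s {n} \<in> {1, -1}" using pat(1) unfolding sign_patterns_def by (rule PiE_mem) simp
    then have "s {n} \<noteq> 0" by auto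
    show "s = t"
    proof (rule sign_patterns_eqI[OF pat])
      fix K assume K: "K \<subseteq> {..<Suc n}"
      show "s K = t K"
      proof (cases "n \<in> K")
        case True
        then have "K = insert n (K - {n})" "K - {n} \<subseteq> {..<n}"
          using K by (auto simp: lessThan_Suc)
        then show ?thesis using con[of "K - {n}"] eq \<open>s {n} \<noteq> 0\<close> by simp
      next
        case False
        then show ?thesis using K by (intro del) (auto simp: lessThan_Suc)
      qed
    qed
  qed
  moreover have "\<Phi> s \<in> ?R n \<times> ?R n \<times> {1, -1}" if "representable (Suc n) s" for s
  proof -
    have "s \<in> Pow {..<Suc n} \<rightarrow>\<^sub>E {1, -1}"
      using that by (simp add: representable_def sign_patterns_def)
    then have "s {n} \<in> {1, -1}" by (rule PiE_mem) simp
    then show ?thesis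
      using representable_delete[OF that] representable_contract[OF that] by (simp add: \<Phi>_def)
  qed
  then have "\<Phi> ` ?R (Suc n) \<subseteq> ?R n \<times> ?R n \<times> {1, -1}" by blast
  ultimately have "card (?R (Suc n)) \<le> card (?R n \<times> ?R n \<times> {1, -1 :: real})"
    by (intro card_inj_on_le) (auto simp: finite_representable)
  then show ?thesis by (simp add: card_cartesian_product power2_eq_square algebra_simps)
qed

lemma card_representable_add:
  "2 * card {s. representable (m + l) s} \<le> (2 * card {s. representable m s}) ^ 2 ^ l"
proof (induction l)
  case (Suc l)
  have "2 * card {s. representable (m + Suc l) s} \<le> (2 * card {s. representable (m + l) s})\<^sup>2"
    using card_representable_Suc[of "m + l"] by simp
  also have "\<dots> \<le> ((2 * card {s. representable m s}) ^ 2 ^ l)\<^sup>2"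
    using Suc by (intro power_mono) auto
  also have "\<dots> = (2 * card {s. representable m s}) ^ 2 ^ Suc l"
    by (simp only: power_mult[symmetric] power_Suc mult.commute[of 2])
  finally show ?case .
qed simp

subsection \<open>Many admissible patterns\<close>

text \<open>With alternating signs \<open>(-1)\<^sup>k\<close> on the sets of size \<open>2k\<close>, admissibility leaves the signs of
  the odd sets unconstrained. The odd sets correspond to the subsets of \<open>{..<n}\<close> by dropping \<open>n\<close>.\<close>

lemma card_admissible_Suc: "2 ^ 2 ^ n \<le> card {s. admissible (Suc n) s}"
proof -
  let ?T = "Pow {..<n} \<rightarrow>\<^sub>E {1, -1 :: real}"
  define S where "S t = (\<lambda>K\<in>Pow {..<Suc n}. if even (card K) then (-1) ^ (card K div 2) else t (K - {n}))"
    for t :: "nat set \<Rightarrow> real"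
  have "admissible (Suc n) (S t)" if t: "t \<in> ?T" for t
    unfolding admissible_def
  proof (intro conjI ballI allI impI)
    show "S t \<in> sign_patterns (Suc n)"
      using t by (auto simp: S_def sign_patterns_def PiE_iff minus_one_power_iff lessThan_Suc)
    show "S t {} = 1" by (simp add: S_def)
    fix i j K
    assume ij: "i \<in> {..<Suc n}" "j \<in> {..<Suc n}" "i \<noteq> j" and K: "K \<subseteq> {..<Suc n} - {i, j}"
      and neq: "S t (K \<union> {i}) \<noteq> S t (K \<union> {j})"
    have "finite K" using K by (meson finite_Diff finite_lessThan finite_subset)
    moreover have "i \<notin> K" "j \<notin> K" using K by auto
    ultimately have card: "card (insert i K) = Suc (card K)" "card (insert j K) = Suc (card K)"
        "card (insert i (insert j K)) = Suc (Suc (card K))"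
      using ij by auto
    have sub: "K \<subseteq> {..<Suc n}" "insert i K \<subseteq> {..<Suc n}" "insert j K \<subseteq> {..<Suc n}"
        "insert i (insert j K) \<subseteq> {..<Suc n}"
      using K ij by auto
    \<comment> \<open>For odd \<open>card K\<close> the sets \<open>K \<union> {i}\<close> and
      \<open>K \<union> {j}\<close> are even of equal size, hence of equal sign. For even
      \<open>card K\<close> the sizes of \<open>K\<close> and \<open>K \<union> {i, j}\<close> give
      opposite signs.\<close>
    have "even (card K)"
    proof (rule ccontr)
      assume "odd (card K)"
      then show False using neq sub by (simp add: S_def card)
    qed
    then show "S t K \<noteq> S t (K \<union> {i, j})"
      using sub by (simp add: S_def card)
  qed
  moreover have "inj_on S ?T"
  proof (rule inj_onI)
    fix t u assume tu: "t \<in> ?T" "u \<in> ?T" "S t = S u"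
    show "t = u"
    proof (rule PiE_ext[OF tu(1,2)])
      fix J assume "J \<in> Pow {..<n}"
      then have J: "J \<subseteq> {..<n}" "finite J" "n \<notin> J" using finite_subset by auto
      \<comment> \<open>Exactly one of \<open>J\<close> and \<open>insert n J\<close> is odd, and
        \<open>S t\<close> takes the free value \<open>t J\<close> there.\<close>
      define K where "K = (if odd (card J) then J else insert n J)"
      have "K \<subseteq> {..<Suc n}" "odd (card K)" "K - {n} = J"
        using J by (auto simp: K_def lessThan_Suc)
      then show "t J = u J" using fun_cong[OF tu(3), of K] by (simp add: S_def)
    qed
  qed
  ultimately have "card ?T \<le> card {s. admissible (Suc n) s}"
    by (intro card_inj_on_le[of S]) (auto simp: finite_admissible)
  then show ?thesis by (simp add: card_PiE card_Pow numeral_2_eq_2)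
qed

section \<open>The probability estimate\<close>

lemma representable_prob_le:
  "representable_prob n \<le> card {s. representable n s} / card {s. admissible n s}"
proof -
  have "card ({s. admissible n s} \<inter> {s. representable n s}) \<le> card {s. representable n s}"
    by (intro card_mono finite_representable) auto
  then show ?thesis
    unfolding representable_prob_def
    by (subst measure_pmf_of_set[OF admissible_nonempty finite_admissible])
      (auto intro: divide_right_mono)
qed

text \<open>Any exponent below \<open>2 ^ 15\<close>, the one of the lower bound for admissible patterns, would do.\<close>

lemma card_representable_16: "2 * card {s. representable 16 s} \<le> 2 ^ 8192"
proof -
  \<comment> \<open>One coordinate for each of the \<open>16 * 16\<close> matrix positions.\<close>
  have "card ({..<16::nat} \<times> {..<16::nat}) \<le> card (UNIV :: 256 set)" by simp
  then obtain idx :: "nat \<times> nat \<Rightarrow> 256" where "inj_on idx ({..<16} \<times> {..<16})"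
    using card_le_inj[of "{..<16::nat} \<times> {..<16::nat}" "UNIV :: 256 set"] by auto
  then have "inj_on (\<lambda>(i, j). curry idx i j) ({..<16} \<times> {..<16})" by simp
  moreover have "CARD(256) = 256" by simp
  ultimately have "card {s. representable 16 s} \<le> (256 * ((2 ^ 16 + 1) * 16) + 1) ^ 256"
    using card_representable_le[of "curry idx" 16] by (metis one_le_numeral numeral_le_iff semiring_norm(68,69,71))
  \<comment> \<open>The base equals \<open>2 ^ 28 + 2 ^ 12 + 1\<close>.\<close>
  also have "\<dots> \<le> (2 ^ 29) ^ 256" by (intro power_mono) simp_all
  finally have "2 * card {s. representable 16 s} \<le> 2 * (2 ^ 29) ^ 256"
    by (rule mult_le_mono2)
  also have "\<dots> = 2 ^ Suc (29 * 256)" by (simp only: power_mult power_Suc)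
  \<comment> \<open>The exponent 7425 is rounded up to \<open>2 ^ 13\<close>, a quarter of
    \<open>2 ^ 15\<close>.\<close>
  also have "\<dots> \<le> (2::nat) ^ 8192" by (intro power_increasing) simp_all
  finally show ?thesis .
qed

lemma representable_prob_small:
  assumes "16 \<le> n"
  shows "representable_prob n \<le> 2 powr (- (1 / 4) * 2 ^ n)"
proof -
  obtain l where l: "n = 16 + l" using assms le_Suc_ex by blast
  define E where "E = (8192 :: nat)"
  have "2 * card {s. representable n s} \<le> (2 * card {s. representable 16 s}) ^ 2 ^ l"
    unfolding l by (rule card_representable_add)
  also have "\<dots> \<le> (2 ^ E) ^ 2 ^ l"
    by (rule power_mono[OF card_representable_16[folded E_def]]) simp
  finally have "card {s. representable n s} \<le> 2 ^ (E * 2 ^ l)" by (simp add: power_mult)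
  then have "real (card {s. representable n s}) \<le> 2 ^ (E * 2 ^ l)"
    by (simp add: of_nat_le_numeral_power_cancel_iff)
  moreover have "2 ^ 2 ^ (15 + l) \<le> card {s. admissible n s}"
    unfolding l using card_admissible_Suc[of "15 + l"] by simp
  then have "2 ^ 2 ^ (15 + l) \<le> real (card {s. admissible n s})"
    by (simp add: numeral_power_le_of_nat_cancel_iff)
  ultimately have "card {s. representable n s} / card {s. admissible n s} \<le> 2 ^ (E * 2 ^ l) / 2 ^ 2 ^ (15 + l)"
    by (intro frac_le) auto
  also have "\<dots> = 2 powr (real (E * 2 ^ l) - real (2 ^ (15 + l)))"
    by (simp only: powr_diff powr_realpow zero_less_numeral)
  \<comment> \<open>The exponent \<open>2 ^ (13 + l) - 2 ^ (15 + l)\<close> is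
    \<open>- 3 * 2 ^ (13 + l)\<close>, while a quarter of \<open>2 ^ n\<close> is only
    \<open>2 * 2 ^ (13 + l)\<close>.\<close>
  also have "\<dots> \<le> 2 powr (- (1 / 4) * 2 ^ n)"
    unfolding l E_def by (simp add: power_add)
  finally show ?thesis using representable_prob_le[of n] by linarith
qed

theorem theorem4p7:
  shows "representable_prob \<longlonglongrightarrow> 0 \<and>
    (\<exists>c>0. \<forall>\<^sub>F n in sequentially. - log 2 (representable_prob n) \<ge> c * 2 ^ n)"
proof
  have lim: "(\<lambda>n. 2 powr (- (1 / 4) * 2 ^ n) :: real) \<longlonglongrightarrow> 0"
    by real_asymp
  have upper: "\<forall>\<^sub>F n in sequentially. representable_prob n \<le> 2 powr (- (1 / 4) * 2 ^ n)"
    using representable_prob_small by (auto simp: eventually_sequentially)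
  have lower: "\<forall>\<^sub>F n in sequentially. 0 \<le> representable_prob n"
    by (simp add: representable_prob_pos less_imp_le)
  show "representable_prob \<longlonglongrightarrow> 0"
    by (rule tendsto_sandwich[OF lower upper tendsto_const lim])
  have "1 / 4 * 2 ^ n \<le> - log 2 (representable_prob n)" if "16 \<le> n" for n
  proof -
    have "log 2 (representable_prob n) \<le> log 2 (2 powr (- (1 / 4) * 2 ^ n))"
      using representable_prob_small[OF that] representable_prob_pos[of n]
      by (subst log_le_cancel_iff) simp_all
    then show ?thesis by simp
  qed
  then show "\<exists>c>0. \<forall>\<^sub>F n in sequentially. - log 2 (representable_prob n) \<ge> c * 2 ^ n"
    by (intro exI[of _ "1 / 4"]) (auto simp: eventually_sequentially)
qed

end
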